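(* Let $X=\mathbb{R}$, let $(\mu_\alpha)$ be a net of Radon sub-probability measures on $X$ and $(t_\alpha)$ a net in $]0,+\infty[$ converging to $0$. Assume that $L(\lambda)$ exists and is finite for all $\lambda$ in a nonempty open interval $G\subset X$. (a) If $$\mathrm{ran}\,{L_{\mid G}}'_-\cup\mathrm{ran}\,{L_{\mid G}}'_+\supset\mathrm{int\,Dom}({L_{\mid G}}^* ),\qquad(\ast)$$ then $(\mu_\alpha)$ satisfies a vague large deviation principle with powers $(t_\alpha)$ and rate function ${L_{\mid G}}^*$. The condition $(\ast)$ is satisfied in particular when $\widehat{L_{\mid G}}$ is essentially smooth. (b) If $0\in G$ and $$\mathrm{ran}\,{L_{\mid G}}'_-\cup\mathrm{ran}\,{L_{\mid G}}'_+\supset\mathrm{int\,Dom}({L_{\mid G}}^* )\cap\{l_1>-L(0)\},$$ then $(\mu_\alpha)$ satisfies a (narrow) large deviation principle with powers $(t_\alpha)$ and rate function ${L_{\mid G}}^*$.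
   Context: For a Borel set $Y$, $\mu_\alpha^{t_\alpha}(Y)=(\mu_\alpha(Y))^{t_\alpha}$. For $\lambda\in\mathbb{R}$, $L(\lambda)=\log\lim_\alpha\left(\int_{\mathbb{R}}e^{\lambda x/t_\alpha}\mu_\alpha(dx)\right)^{t_\alpha}$ in $[-\infty,+\infty]$, when this limit exists (in $[0,+\infty]$, with $\log 0=-\infty$, $\log(+\infty)=+\infty$). For $x\in X$, $l_1(x)=-\log\inf\{\liminf_\alpha\mu_\alpha^{t_\alpha}(V):x\in V\subset X,\ V\text{ open}\}$, and $\{l_1>c\}=\{x:l_1(x)>c\}$. When $L$ is finite on the open interval $G$, $L_{\mid G}$ is convex; ${L_{\mid G}}'_-$ and ${L_{\mid G}}'_+$ are its left and right derivatives (functions on $G$), and $\mathrm{ran}$ denotes the range. $\widehat{L_{\mid G}}$ is the convex function on $\mathbb{R}$ equal to $L$ on $G$ and to $+\infty$ outside $G$; ${L_{\mid G}}^*(x)=\sup_{\lambda\in G}\{\lambda x-L(\lambda)\}$. For a $[-\infty,+\infty]$-valued function $f$, $\mathrm{Dom}(f)=\{f<+\infty\}$, and $\mathrm{int\,Dom}(f)$, $\mathrm{bd\,Dom}(f)$ are its topological interior and boundary. A convex function on $\mathbb{R}$ is proper if it never takes the value $-\infty$ and is finite at some point. A proper convex function $f$ on $\mathbb{R}$ is essentially smooth if $\mathrm{int\,Dom}(f)\neq\emptyset$, $f$ is differentiable on $\mathrm{int\,Dom}(f)$, and $\lim|f'(x_n)|=+\infty$ for all sequences $(x_n)$ in $\mathrm{int\,Dom}(f)$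 converging to some $x\in\mathrm{bd\,Dom}(f)$. $(\mu_\alpha)$ satisfies a (narrow) large deviation principle with powers $(t_\alpha)$ and rate function $J$ if $J:X\to[0,+\infty]$ is lower semi-continuous, $\limsup_\alpha\mu_\alpha^{t_\alpha}(F)\le\sup_{x\in F}e^{-J(x)}$ for all closed $F\subset X$, and $\sup_{x\in V}e^{-J(x)}\le\liminf_\alpha\mu_\alpha^{t_\alpha}(V)$ for all open $V\subset X$ (the supremum over the empty set being $0$ here). If "closed" is replaced by "compact" in the upper bound, the principle is called vague. *)

theory Defs
  imports "HOL-Probability.Probability"
begin

definition directed_set :: "'i set \<Rightarrow> ('i \<Rightarrow> 'i \<Rightarrow> bool) \<Rightarrow> bool" where
  "directed_set A le \<longleftrightarrow> A \<noteq> {} \<and> (\<forall>a\<in>A. le a a) \<and>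
     (\<forall>a\<in>A. \<forall>b\<in>A. \<forall>c\<in>A. le a b \<longrightarrow> le b c \<longrightarrow> le a c) \<and>
     (\<forall>a\<in>A. \<forall>b\<in>A. \<exists>c\<in>A. le a c \<and> le b c)"

text \<open>Filter of tails of a directed set: limits, lower and upper limits of a net indexed by
  \<open>A\<close> are those along this filter.\<close>

definition net_filter :: "'i set \<Rightarrow> ('i \<Rightarrow> 'i \<Rightarrow> bool) \<Rightarrow> 'i filter" where
  "net_filter A le = (INF a\<in>A. principal {b\<in>A. le a b})"

definition radon_subprob :: "real measure \<Rightarrow> bool" where
  "radon_subprob M \<longleftrightarrow> sets M = sets borel \<and> subprob_space M \<and>
     (\<forall>B\<in>sets borel. emeasure M B = (SUP K\<in>{K. compact K \<and> K \<subseteq> B}. emeasure M K))"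

text \<open>Power with exponent \<open>p > 0\<close>, logarithm and \<open>x \<mapsto> e\<^sup>-\<^sup>x\<close> with extended values. The function
  \<^term>\<open>exp_neg\<close> is applied only to arguments in \<open>[0, \<infinity>]\<close>.\<close>

definition epow :: "ennreal \<Rightarrow> real \<Rightarrow> ennreal" where
  "epow x p = (if x = \<infinity> then \<infinity> else ennreal (enn2real x powr p))"

definition elog :: "ennreal \<Rightarrow> ereal" where
  "elog x = (if x = 0 then -\<infinity> else if x = \<infinity> then \<infinity> else ereal (ln (enn2real x)))"

definition exp_neg :: "ereal \<Rightarrow> ennreal" where
  "exp_neg x = (if x = \<infinity> then 0 else ennreal (exp (- real_of_ereal x)))"

definition mu_pow :: "('i \<Rightarrow> real measure) \<Rightarrow> ('i \<Rightarrow> real) \<Rightarrow> 'i \<Rightarrow> real set \<Rightarrow> ennreal" where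
  "mu_pow \<mu> t \<alpha> Y = epow (emeasure (\<mu> \<alpha>) Y) (t \<alpha>)"

definition laplace_pow :: "('i \<Rightarrow> real measure) \<Rightarrow> ('i \<Rightarrow> real) \<Rightarrow> real \<Rightarrow> 'i \<Rightarrow> ennreal" where
  "laplace_pow \<mu> t s \<alpha> = epow (\<integral>\<^sup>+x. ennreal (exp (s * x / t \<alpha>)) \<partial>\<mu> \<alpha>) (t \<alpha>)"

definition L_exists :: "'i filter \<Rightarrow> ('i \<Rightarrow> real measure) \<Rightarrow> ('i \<Rightarrow> real) \<Rightarrow> real \<Rightarrow> bool" where
  "L_exists F \<mu> t s \<longleftrightarrow> (\<exists>l. (laplace_pow \<mu> t s \<longlongrightarrow> l) F)"

text \<open>Meaningful only where \<^const>\<open>L_exists\<close> holds.\<close>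

definition L_fun :: "'i filter \<Rightarrow> ('i \<Rightarrow> real measure) \<Rightarrow> ('i \<Rightarrow> real) \<Rightarrow> real \<Rightarrow> ereal" where
  "L_fun F \<mu> t s = elog (Lim F (laplace_pow \<mu> t s))"

definition l1 :: "'i filter \<Rightarrow> ('i \<Rightarrow> real measure) \<Rightarrow> ('i \<Rightarrow> real) \<Rightarrow> real \<Rightarrow> ereal" where
  "l1 F \<mu> t x =
     - elog (INF V\<in>{V. open V \<and> x \<in> V}. Liminf F (\<lambda>\<alpha>. mu_pow \<mu> t \<alpha> V))"

text \<open>Ranges of the one-sided derivatives on an open set \<open>G\<close> where \<open>f\<close> is finite.\<close>

definition ran_left_deriv :: "(real \<Rightarrow> ereal) \<Rightarrow> real set \<Rightarrow> real set" where
  "ran_left_deriv f G =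
     {D. \<exists>x\<in>G. ((\<lambda>y. real_of_ereal (f y)) has_real_derivative D) (at_left x)}"

definition ran_right_deriv :: "(real \<Rightarrow> ereal) \<Rightarrow> real set \<Rightarrow> real set" where
  "ran_right_deriv f G =
     {D. \<exists>x\<in>G. ((\<lambda>y. real_of_ereal (f y)) has_real_derivative D) (at_right x)}"

definition ext_infty :: "(real \<Rightarrow> ereal) \<Rightarrow> real set \<Rightarrow> real \<Rightarrow> ereal" where
  "ext_infty f G s = (if s \<in> G then f s else \<infinity>)"

definition conj_on :: "(real \<Rightarrow> ereal) \<Rightarrow> real set \<Rightarrow> real \<Rightarrow> ereal" where
  "conj_on f G x = (SUP s\<in>G. ereal (s * x) - f s)"

definition edom :: "(real \<Rightarrow> ereal) \<Rightarrow> real set" where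
  "edom f = {x. f x < \<infinity>}"

definition proper_convex :: "(real \<Rightarrow> ereal) \<Rightarrow> bool" where
  "proper_convex f \<longleftrightarrow> convex {(x, r::real). f x \<le> ereal r} \<and>
     (\<forall>x. f x \<noteq> -\<infinity>) \<and> (\<exists>x. \<bar>f x\<bar> \<noteq> \<infinity>)"

definition essentially_smooth :: "(real \<Rightarrow> ereal) \<Rightarrow> bool" where
  "essentially_smooth f \<longleftrightarrow> proper_convex f \<and> interior (edom f) \<noteq> {} \<and>
     (\<forall>x\<in>interior (edom f). (\<lambda>y. real_of_ereal (f y)) differentiable (at x)) \<and>
     (\<forall>X. \<forall>x\<in>frontier (edom f). (\<forall>n. X n \<in> interior (edom f)) \<and> X \<longlonglongrightarrow> x \<longrightarrow>
        filterlim (\<lambda>n::nat. \<bar>deriv (\<lambda>y. real_of_ereal (f y)) (X n)\<bar>) at_top sequentially)"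

definition lower_semicont :: "(real \<Rightarrow> ereal) \<Rightarrow> bool" where
  "lower_semicont J \<longleftrightarrow> (\<forall>c. closed {x. J x \<le> c})"

text \<open>Large deviation principle whose upper bound ranges over the sets satisfying \<open>P\<close>.
  In \<^typ>\<open>ennreal\<close> the supremum of the empty set is \<open>0\<close>.\<close>

definition ldp_upper_on ::
  "(real set \<Rightarrow> bool) \<Rightarrow> 'i filter \<Rightarrow> ('i \<Rightarrow> real measure) \<Rightarrow> ('i \<Rightarrow> real) \<Rightarrow> (real \<Rightarrow> ereal) \<Rightarrow> bool"
where
  "ldp_upper_on P F \<mu> t J \<longleftrightarrow> (\<forall>x. 0 \<le> J x) \<and> lower_semicont J \<and>
     (\<forall>C. P C \<longrightarrow> Limsup F (\<lambda>\<alpha>. mu_pow \<mu> t \<alpha> C) \<le> (SUP x\<in>C. exp_neg (J x))) \<and>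
     (\<forall>V. open V \<longrightarrow> (SUP x\<in>V. exp_neg (J x)) \<le> Liminf F (\<lambda>\<alpha>. mu_pow \<mu> t \<alpha> V))"

definition narrow_LDP ::
  "'i filter \<Rightarrow> ('i \<Rightarrow> real measure) \<Rightarrow> ('i \<Rightarrow> real) \<Rightarrow> (real \<Rightarrow> ereal) \<Rightarrow> bool" where
  "narrow_LDP = ldp_upper_on closed"

definition vague_LDP ::
  "'i filter \<Rightarrow> ('i \<Rightarrow> real measure) \<Rightarrow> ('i \<Rightarrow> real) \<Rightarrow> (real \<Rightarrow> ereal) \<Rightarrow> bool" where
  "vague_LDP = ldp_upper_on compact"

end

theory Submission
  imports Defs
begin

text \<open>The measures are tilted exponentially. Chernoff's inequality and a covering argument give the
  upper bound on compact sets, and on closed sets when \<open>0 \<in> G\<close> makes the net exponentially tight.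
  Under the measure tilted by \<open>s\<close>, Chernoff's inequality shows that an interval \<open>(a, b)\<close> carries the
  dominant exponential rate as soon as \<open>L\<close> has a chord of slope \<open>> a\<close> ending at \<open>s\<close> and one of slope
  \<open>< b\<close> starting at \<open>s\<close>; letting \<open>s\<close> tend to \<open>\<theta>\<close> from the left or from the right gives the lower
  bound at a one-sided derivative of \<open>L\<close> at \<open>\<theta>\<close>. In part (b) the lower bound is automatic where
  \<open>l\<^sub>1 \<le> - L 0\<close>, since \<open>- L 0\<close> is a lower bound of the conjugate. Boundary points of the domain of
  the conjugate are approached along segments; if the domain has empty interior, \<open>L\<close> is affine.
  Nonnegativity of the conjugate is the lower bound for the open set \<open>UNIV\<close>.\<close>

subsection \<open>Powers with vanishing exponent\<close>

lemma epow_mono: "x \<le> y \<Longrightarrow> 0 < p \<Longrightarrow> epow x p \<le> epow y p"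
  by (cases x; cases y) (auto simp: epow_def top_unique intro!: ennreal_leI powr_mono2)

lemma epow_cmult: "0 < c \<Longrightarrow> 0 < p \<Longrightarrow> epow (ennreal c * x) p = ennreal (c powr p) * epow x p"
  by (cases x) (auto simp: epow_def ennreal_mult_top powr_mult simp flip: ennreal_mult)

lemma epow_1 [simp]: "epow 1 p = 1"
  by (simp add: epow_def)

lemma epow_max: "0 < p \<Longrightarrow> epow (max x y) p = max (epow x p) (epow y p)"
  by (metis epow_mono linorder_linear max.absorb1 max.absorb2)

text \<open>A sum is at most twice its larger term, and the power turns the 2 into
  \<open>2 powr p\<close>.\<close>

lemma epow_add_le:
  assumes "0 < p"
  shows "epow (x + y) p \<le> ennreal (2 powr p) * max (epow x p) (epow y p)"
proof -
  have "x + y \<le> max x y + max x y" by (intro add_mono) auto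
  also have "\<dots> = ennreal 2 * max x y" by (simp add: mult_2)
  finally have "epow (x + y) p \<le> epow (ennreal 2 * max x y) p"
    using assms by (rule epow_mono)
  then show ?thesis using assms by (simp only: epow_cmult epow_max zero_less_numeral)
qed

text \<open>Adding up finitely many terms costs a factor \<open>2\<^sup>t \<rightarrow> 1\<close> only, so the largest exponential
  rate wins.\<close>

locale vanishing_exponent =
  fixes F :: "'i filter" and t :: "'i \<Rightarrow> real"
  assumes F_nontriv: "F \<noteq> bot"
    and t_pos: "eventually (\<lambda>\<alpha>. 0 < t \<alpha>) F"
    and t_zero: "(t \<longlongrightarrow> 0) F"
begin

lemma two_powr_tendsto: "((\<lambda>\<alpha>. ennreal (2 powr t \<alpha>)) \<longlongrightarrow> 1) F"
  using tendsto_ennrealI[OF tendsto_powr[OF tendsto_const t_zero, of 2]] by simp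

lemma eventually_two_powr_mult_less:
  assumes "c < (d::ennreal)"
  shows "eventually (\<lambda>\<alpha>. ennreal (2 powr t \<alpha>) * c < d) F"
proof -
  have "((\<lambda>\<alpha>. ennreal (2 powr t \<alpha>) * c) \<longlongrightarrow> 1 * c) F"
    using assms by (intro tendsto_mult_ennreal two_powr_tendsto tendsto_const) auto
  with assms show ?thesis by (auto dest: order_tendstoD(2))
qed

lemma Limsup_epow_add:
  "Limsup F (\<lambda>\<alpha>. epow (f \<alpha> + g \<alpha>) (t \<alpha>))
     \<le> max (Limsup F (\<lambda>\<alpha>. epow (f \<alpha>) (t \<alpha>))) (Limsup F (\<lambda>\<alpha>. epow (g \<alpha>) (t \<alpha>)))"
  (is "_ \<le> ?m")
  unfolding Limsup_le_iff
proof safe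
  fix d assume "?m < d"
  \<comment> \<open>The room between \<open>c\<close> and \<open>d\<close> absorbs the factor
    \<open>2 powr t \<alpha>\<close>, which tends to 1.\<close>
  then obtain c where c: "?m < c" "c < d" using dense by blast
  have "Limsup F (\<lambda>\<alpha>. epow (f \<alpha>) (t \<alpha>)) < c" "Limsup F (\<lambda>\<alpha>. epow (g \<alpha>) (t \<alpha>)) < c"
    using c by auto
  then have "eventually (\<lambda>\<alpha>. epow (f \<alpha>) (t \<alpha>) < c) F" "eventually (\<lambda>\<alpha>. epow (g \<alpha>) (t \<alpha>) < c) F"
    by (auto intro: Limsup_lessD)
  then show "eventually (\<lambda>\<alpha>. epow (f \<alpha> + g \<alpha>) (t \<alpha>) < d) F"
    using t_pos eventually_two_powr_mult_less[OF c(2)]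
  proof eventually_elim
    case (elim \<alpha>)
    have "epow (f \<alpha> + g \<alpha>) (t \<alpha>) \<le> ennreal (2 powr t \<alpha>) * max (epow (f \<alpha>) (t \<alpha>)) (epow (g \<alpha>) (t \<alpha>))"
      using elim by (intro epow_add_le)
    also have "\<dots> \<le> ennreal (2 powr t \<alpha>) * c"
      using elim by (intro mult_left_mono) auto
    finally show ?case using elim by auto
  qed
qed

text \<open>If both parts were at most some \<open>c < l\<close> far along the net, the sum would be
  at most \<open>2 powr t \<alpha>\<close> times \<open>c\<close>, hence below some
  \<open>d < l\<close>, against the convergence to \<open>l\<close>.\<close>

lemma Liminf_epow_dominant:
  assumes lim: "((\<lambda>\<alpha>. epow (f \<alpha> + g \<alpha>) (t \<alpha>)) \<longlongrightarrow> l) F"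
    and g: "Limsup F (\<lambda>\<alpha>. epow (g \<alpha>) (t \<alpha>)) < l"
  shows "l \<le> Liminf F (\<lambda>\<alpha>. epow (f \<alpha>) (t \<alpha>))"
  unfolding le_Liminf_iff
proof safe
  fix y assume "y < l"
  with g obtain c where c: "y < c" "Limsup F (\<lambda>\<alpha>. epow (g \<alpha>) (t \<alpha>)) < c" "c < l"
    using dense[of "max y (Limsup F (\<lambda>\<alpha>. epow (g \<alpha>) (t \<alpha>)))" l] by auto
  obtain d where d: "c < d" "d < l" using dense c by blast
  have "eventually (\<lambda>\<alpha>. epow (g \<alpha>) (t \<alpha>) < c) F"
    using c(2) by (rule Limsup_lessD)
  then show "eventually (\<lambda>\<alpha>. y < epow (f \<alpha>) (t \<alpha>)) F"
    using t_pos eventually_two_powr_mult_less[OF d(1)] order_tendstoD(1)[OF lim d(2)]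
  proof eventually_elim
    case (elim \<alpha>)
    show ?case
    proof (rule ccontr)
      assume "\<not> ?thesis"
      then have "max (epow (f \<alpha>) (t \<alpha>)) (epow (g \<alpha>) (t \<alpha>)) \<le> c" using elim c by auto
      then have "ennreal (2 powr t \<alpha>) * max (epow (f \<alpha>) (t \<alpha>)) (epow (g \<alpha>) (t \<alpha>)) \<le> ennreal (2 powr t \<alpha>) * c"
        by (intro mult_left_mono) auto
      with epow_add_le[of "t \<alpha>" "f \<alpha>" "g \<alpha>"] elim show False by auto
    qed
  qed
qed

end

subsection \<open>Exponential tilting\<close>

text \<open>The normalisation \<open>m\<close> contributes the factor \<open>exp (- m)\<close> after
  the power \<open>t \<alpha>\<close>, so that two tilts can be compared by comparing exponents on
  \<open>B\<close>. The choice \<open>s = m = 0\<close> recovers \<open>mu_pow\<close> on Borel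
  sets.\<close>

definition tilt :: "('i \<Rightarrow> real measure) \<Rightarrow> ('i \<Rightarrow> real) \<Rightarrow> real \<Rightarrow> real \<Rightarrow> real set \<Rightarrow> 'i \<Rightarrow> ennreal" where
  "tilt \<mu> t s m B \<alpha> = epow (\<integral>\<^sup>+y. ennreal (exp ((s * y - m) / t \<alpha>)) * indicator B y \<partial>\<mu> \<alpha>) (t \<alpha>)"

text \<open>\<open>\<Lambda>\<close> stands for the real values of L on \<open>G\<close>. Its
  convexity is derived from the limits below, not assumed.\<close>

locale gaertner_ellis = vanishing_exponent F t for F :: "'i filter" and t +
  fixes \<mu> :: "'i \<Rightarrow> real measure" and \<Lambda> :: "real \<Rightarrow> real" and G :: "real set"
  assumes sets_mu: "eventually (\<lambda>\<alpha>. sets (\<mu> \<alpha>) = sets borel) F"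
    and subprob_mu: "eventually (\<lambda>\<alpha>. subprob_space (\<mu> \<alpha>)) F"
    and open_G: "open G" and interval_G: "is_interval G" and G_nonempty: "G \<noteq> {}"
    and laplace_lim: "s \<in> G \<Longrightarrow> (laplace_pow \<mu> t s \<longlongrightarrow> ennreal (exp (\<Lambda> s))) F"
begin

abbreviation "rate \<equiv> conj_on (\<lambda>s. ereal (\<Lambda> s)) G"

lemma tilt_mono:
  assumes "\<And>y. y \<in> B \<Longrightarrow> y \<in> C \<and> r * y - k \<le> s * y - m" and "0 < t \<alpha>"
  shows "tilt \<mu> t r k B \<alpha> \<le> tilt \<mu> t s m C \<alpha>"
  unfolding tilt_def using assms
  by (intro epow_mono nn_integral_mono)
     (auto simp: indicator_def intro!: ennreal_leI divide_right_mono)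

lemma mu_pow_eq_tilt:
  assumes "B \<in> sets borel"
  shows "eventually (\<lambda>\<alpha>. mu_pow \<mu> t \<alpha> B = tilt \<mu> t 0 0 B \<alpha>) F"
  using sets_mu by eventually_elim (use assms in \<open>simp add: mu_pow_def tilt_def\<close>)

lemma tilt_UNIV_tendsto:
  assumes "s \<in> G"
  shows "(tilt \<mu> t s m UNIV \<longlongrightarrow> ennreal (exp (\<Lambda> s - m))) F"
proof -
  have "((\<lambda>\<alpha>. ennreal (exp (-m)) * laplace_pow \<mu> t s \<alpha>) \<longlongrightarrow> ennreal (exp (-m)) * ennreal (exp (\<Lambda> s))) F"
    by (intro ennreal_tendsto_cmult laplace_lim assms) simp
  also have "ennreal (exp (-m)) * ennreal (exp (\<Lambda> s)) = ennreal (exp (\<Lambda> s - m))"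
    by (simp add: exp_minus exp_diff field_simps flip: ennreal_mult)
  also have "eventually (\<lambda>\<alpha>. ennreal (exp (-m)) * laplace_pow \<mu> t s \<alpha> = tilt \<mu> t s m UNIV \<alpha>) F"
    using t_pos sets_mu
  proof eventually_elim
    case (elim \<alpha>)
    have "(\<integral>\<^sup>+y. ennreal (exp ((s * y - m) / t \<alpha>)) \<partial>\<mu> \<alpha>)
        = (\<integral>\<^sup>+y. ennreal (exp (- m / t \<alpha>)) * ennreal (exp (s * y / t \<alpha>)) \<partial>\<mu> \<alpha>)"
      by (intro nn_integral_cong) (simp add: diff_divide_distrib exp_diff exp_minus field_simps flip: ennreal_mult)
    also have "\<dots> = ennreal (exp (- m / t \<alpha>)) * (\<integral>\<^sup>+y. ennreal (exp (s * y / t \<alpha>)) \<partial>\<mu> \<alpha>)"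
      using elim by (intro nn_integral_cmult) (simp add: measurable_cong_sets[OF elim(2) refl])
    finally show ?case
      using elim by (simp add: tilt_def laplace_pow_def epow_cmult powr_def)
  qed
  then have "((\<lambda>\<alpha>. ennreal (exp (-m)) * laplace_pow \<mu> t s \<alpha>) \<longlongrightarrow> ennreal (exp (\<Lambda> s - m))) F
     \<longleftrightarrow> (tilt \<mu> t s m UNIV \<longlongrightarrow> ennreal (exp (\<Lambda> s - m))) F"
    by (rule tendsto_cong)
  finally show ?thesis .
qed

text \<open>Chernoff's inequality: on \<open>B\<close> the integrand is dominated by the one for
  \<open>s\<close> and \<open>m\<close>, and enlarging \<open>B\<close> to the whole line gives an
  integral whose limit is known.\<close>

lemma Limsup_tilt_le:
  assumes "s \<in> G" and "\<And>y. y \<in> B \<Longrightarrow> r * y - k \<le> s * y - m"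
  shows "Limsup F (tilt \<mu> t r k B) \<le> ennreal (exp (\<Lambda> s - m))"
proof -
  have "Limsup F (tilt \<mu> t r k B) \<le> Limsup F (tilt \<mu> t s m UNIV)"
    by (rule Limsup_mono, use t_pos in eventually_elim) (use assms in \<open>auto intro!: tilt_mono\<close>)
  also have "\<dots> = ennreal (exp (\<Lambda> s - m))"
    by (intro lim_imp_Limsup F_nontriv tilt_UNIV_tendsto assms)
  finally show ?thesis .
qed

lemma tilt_Un_le:
  assumes "A \<in> sets borel" "B \<in> sets borel" "sets (\<mu> \<alpha>) = sets borel" "0 < t \<alpha>"
  shows "tilt \<mu> t s m (A \<union> B) \<alpha> \<le>
    epow ((\<integral>\<^sup>+y. ennreal (exp ((s * y - m) / t \<alpha>)) * indicator A y \<partial>\<mu> \<alpha>)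
        + (\<integral>\<^sup>+y. ennreal (exp ((s * y - m) / t \<alpha>)) * indicator B y \<partial>\<mu> \<alpha>)) (t \<alpha>)"
proof -
  have "(\<integral>\<^sup>+y. ennreal (exp ((s * y - m) / t \<alpha>)) * indicator (A \<union> B) y \<partial>\<mu> \<alpha>)
    \<le> (\<integral>\<^sup>+y. ennreal (exp ((s * y - m) / t \<alpha>)) * indicator A y
            + ennreal (exp ((s * y - m) / t \<alpha>)) * indicator B y \<partial>\<mu> \<alpha>)"
    by (intro nn_integral_mono) (auto simp: indicator_def)
  also have "\<dots> = (\<integral>\<^sup>+y. ennreal (exp ((s * y - m) / t \<alpha>)) * indicator A y \<partial>\<mu> \<alpha>)
        + (\<integral>\<^sup>+y. ennreal (exp ((s * y - m) / t \<alpha>)) * indicator B y \<partial>\<mu> \<alpha>)"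
    using assms by (intro nn_integral_add) (simp_all add: measurable_cong_sets[OF assms(3) refl])
  finally show ?thesis unfolding tilt_def using assms(4) by (rule epow_mono)
qed

lemma Limsup_tilt_Un:
  assumes "A \<in> sets borel" "B \<in> sets borel"
  shows "Limsup F (tilt \<mu> t s m (A \<union> B)) \<le> max (Limsup F (tilt \<mu> t s m A)) (Limsup F (tilt \<mu> t s m B))"
  unfolding tilt_def[of _ _ _ _ A, abs_def] tilt_def[of _ _ _ _ B, abs_def]
  by (rule order_trans[OF Limsup_mono Limsup_epow_add], use t_pos sets_mu in eventually_elim)
     (use assms in \<open>auto intro!: tilt_Un_le\<close>)

text \<open>Under the tilt by \<open>s\<close> the chord conditions give both tails a strictly
  smaller rate than the total mass, so the interval carries the whole rate. Undoing the tilt costs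
  nothing because \<open>m\<close> bounds \<open>s * y\<close> on the interval.\<close>

lemma Liminf_mu_pow_interval:
  assumes "r \<in> G" "s \<in> G" "q \<in> G" and rsq: "r < s" "s < q"
    and left: "a * (s - r) < \<Lambda> s - \<Lambda> r" and right: "\<Lambda> q - \<Lambda> s < b * (q - s)"
    and m: "\<And>y. a < y \<Longrightarrow> y < b \<Longrightarrow> s * y \<le> m"
  shows "ennreal (exp (\<Lambda> s - m)) \<le> Liminf F (\<lambda>\<alpha>. mu_pow \<mu> t \<alpha> {a<..<b})"
proof -
  let ?I = "\<lambda>B \<alpha>. \<integral>\<^sup>+y. ennreal (exp ((s * y - m) / t \<alpha>)) * indicator B y \<partial>\<mu> \<alpha>"
  let ?C = "- {a<..<b}"
  \<comment> \<open>The left tail is compared with the smaller parameter \<open>r\<close>, the right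
    tail below with the larger \<open>q\<close>. The constants make the two exponents agree at the
    endpoint \<open>a\<close> or \<open>b\<close>.\<close>
  have "Limsup F (tilt \<mu> t s m {..a}) \<le> ennreal (exp (\<Lambda> r - (m - (s - r) * a)))"
  proof (rule Limsup_tilt_le[OF \<open>r \<in> G\<close>])
    fix y assume "y \<in> {..a}"
    then have "(s - r) * y \<le> (s - r) * a" using rsq by (intro mult_left_mono) auto
    then show "s * y - m \<le> r * y - (m - (s - r) * a)" by (simp add: algebra_simps)
  qed
  also have "\<dots> < ennreal (exp (\<Lambda> s - m))"
    using left by (intro ennreal_lessI) (auto simp: algebra_simps)
  finally have 1: "Limsup F (tilt \<mu> t s m {..a}) < ennreal (exp (\<Lambda> s - m))" .
  have "Limsup F (tilt \<mu> t s m {b..}) \<le> ennreal (exp (\<Lambda> q - (m + (q - s) * b)))"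
  proof (rule Limsup_tilt_le[OF \<open>q \<in> G\<close>])
    fix y assume "y \<in> {b..}"
    then have "(q - s) * b \<le> (q - s) * y" using rsq by (intro mult_left_mono) auto
    then show "s * y - m \<le> q * y - (m + (q - s) * b)" by (simp add: algebra_simps)
  qed
  also have "\<dots> < ennreal (exp (\<Lambda> s - m))"
    using right by (intro ennreal_lessI) (auto simp: algebra_simps)
  finally have 2: "Limsup F (tilt \<mu> t s m {b..}) < ennreal (exp (\<Lambda> s - m))" .
  have "?C = {..a} \<union> {b..}" by auto
  then have C: "Limsup F (tilt \<mu> t s m ?C) < ennreal (exp (\<Lambda> s - m))"
    using Limsup_tilt_Un[of "{..a}" "{b..}" s m] 1 2 by (auto simp: max_def split: if_splits)
  have eq: "eventually (\<lambda>\<alpha>. tilt \<mu> t s m UNIV \<alpha> = epow (?I {a<..<b} \<alpha> + ?I ?C \<alpha>) (t \<alpha>)) F"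
    using sets_mu
  proof eventually_elim
    case (elim \<alpha>)
    have "?I {a<..<b} \<alpha> + ?I ?C \<alpha> = (\<integral>\<^sup>+y. ennreal (exp ((s * y - m) / t \<alpha>)) * indicator {a<..<b} y
        + ennreal (exp ((s * y - m) / t \<alpha>)) * indicator ?C y \<partial>\<mu> \<alpha>)"
      by (intro nn_integral_add[symmetric]) (simp_all add: measurable_cong_sets[OF elim refl])
    also have "\<dots> = ?I UNIV \<alpha>"
      by (intro nn_integral_cong) (auto simp: indicator_def)
    finally show ?case by (simp add: tilt_def)
  qed
  have "((\<lambda>\<alpha>. epow (?I {a<..<b} \<alpha> + ?I ?C \<alpha>) (t \<alpha>)) \<longlongrightarrow> ennreal (exp (\<Lambda> s - m))) F"
    using tilt_UNIV_tendsto[OF \<open>s \<in> G\<close>, of m] tendsto_cong[OF eq] by blast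
  then have "ennreal (exp (\<Lambda> s - m)) \<le> Liminf F (\<lambda>\<alpha>. epow (?I {a<..<b} \<alpha>) (t \<alpha>))"
    by (rule Liminf_epow_dominant) (use C in \<open>simp add: tilt_def[abs_def]\<close>)
  also have "\<dots> = Liminf F (tilt \<mu> t s m {a<..<b})" by (simp add: tilt_def[abs_def])
  \<comment> \<open>On the interval the exponent \<open>s * y - m\<close> is at most 0, so the
    tilted integral is at most the mass.\<close>
  also have "\<dots> \<le> Liminf F (\<lambda>\<alpha>. mu_pow \<mu> t \<alpha> {a<..<b})"
  proof (rule Liminf_mono)
    show "eventually (\<lambda>\<alpha>. tilt \<mu> t s m {a<..<b} \<alpha> \<le> mu_pow \<mu> t \<alpha> {a<..<b}) F"
      using t_pos mu_pow_eq_tilt[of "{a<..<b}", simplified]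
      by eventually_elim (use m in \<open>auto intro!: tilt_mono\<close>)
  qed
  finally show ?thesis .
qed

end

subsection \<open>The conjugate and the lower bound\<close>

lemma exp_neg_le: "ereal c \<le> J \<Longrightarrow> exp_neg J \<le> ennreal (exp (- c))"
  by (cases J) (auto simp: exp_neg_def intro!: ennreal_leI)

text \<open>The value \<open>-\<infinity>\<close> must be excluded because \<open>exp_neg\<close>
  takes the default value 1 there.\<close>

lemma exp_neg_ge: "J \<le> ereal c \<Longrightarrow> J \<noteq> -\<infinity> \<Longrightarrow> ennreal (exp (- c)) \<le> exp_neg J"
  by (cases J) (auto simp: exp_neg_def intro!: ennreal_leI)

lemma exp_le_if_le_elog: "ereal k \<le> elog x \<Longrightarrow> ennreal (exp k) \<le> x"
proof (cases x)
  case (real r)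
  assume *: "ereal k \<le> elog x"
  then have "r > 0" "k \<le> ln r"
    using real by (auto simp: elog_def split: if_splits)
  then show ?thesis using real by (auto simp: ln_ge_iff intro!: ennreal_leI)
qed simp

context gaertner_ellis
begin

lemma rate_ge: "s \<in> G \<Longrightarrow> ereal (s * x - \<Lambda> s) \<le> rate x"
  unfolding conj_on_def by (rule SUP_upper2) auto

lemma rate_le_iff: "rate x \<le> ereal c \<longleftrightarrow> (\<forall>s\<in>G. s * x - \<Lambda> s \<le> c)"
  unfolding conj_on_def by (auto simp: SUP_le_iff)

lemma rate_not_MInfty: "rate x \<noteq> -\<infinity>"
proof -
  obtain s where "s \<in> G" using G_nonempty by blast
  from rate_ge[OF this, of x] show ?thesis by auto
qed

lemma rate_edomE:
  assumes "x \<in> edom rate"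
  obtains c where "rate x = ereal c"
  using assms rate_not_MInfty[of x] by (cases "rate x") (auto simp: edom_def)

text \<open>Each affine term of the supremum obeys the bound, hence so does the supremum. Real
  bounds \<open>a\<close> and \<open>b\<close> avoid sums of extended values.\<close>

lemma rate_convex_comb:
  assumes "rate x \<le> ereal a" "rate z \<le> ereal b" "0 \<le> u" "u \<le> 1"
  shows "rate ((1 - u) * x + u * z) \<le> ereal ((1 - u) * a + u * b)"
  unfolding rate_le_iff
proof
  fix s assume "s \<in> G"
  then have "s * x - \<Lambda> s \<le> a" "s * z - \<Lambda> s \<le> b" using assms by (auto simp: rate_le_iff)
  then have "(1 - u) * (s * x - \<Lambda> s) + u * (s * z - \<Lambda> s) \<le> (1 - u) * a + u * b"
    using assms by (intro add_mono mult_left_mono) auto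
  then show "s * ((1 - u) * x + u * z) - \<Lambda> s \<le> (1 - u) * a + u * b"
    by (simp add: algebra_simps)
qed

lemma convex_edom_rate: "convex (edom rate)"
  unfolding convex_alt
proof safe
  fix x z u :: real assume *: "x \<in> edom rate" "z \<in> edom rate" "0 \<le> u" "u \<le> 1"
  obtain a b where "rate x = ereal a" "rate z = ereal b" using * rate_edomE by metis
  then have "rate ((1 - u) * x + u * z) \<le> ereal ((1 - u) * a + u * b)"
    using * by (intro rate_convex_comb) auto
  then show "(1 - u) *\<^sub>R x + u *\<^sub>R z \<in> edom rate"
    by (auto simp: edom_def intro: le_less_trans)
qed

lemma lower_semicont_rate: "lower_semicont rate"
  unfolding lower_semicont_def
proof
  fix c
  have "{x. rate x \<le> c} = (\<Inter>s\<in>G. {x. ereal (s * x - \<Lambda> s) \<le> c})"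
    by (auto simp: conj_on_def SUP_le_iff)
  also have "closed \<dots>"
    by (intro closed_INT ballI closed_Collect_le continuous_intros)
  finally show "closed {x. rate x \<le> c}" .
qed

text \<open>Convexity comes from Chernoff bounds. The weighted mean of
  \<open>x * v - \<Lambda> x\<close> and \<open>y * v - \<Lambda> y\<close> is
  \<open>?z * v - ?m\<close>, so at every \<open>v\<close> one of the two is at least this mean.
  Splitting the line accordingly bounds the rate of the total mass tilted by \<open>?z\<close> by
  the larger of two rates, each at most 1.\<close>

lemma convex_on_\<Lambda>: "convex_on G \<Lambda>"
proof (rule convex_onI)
  show "convex G" using interval_G by (simp add: is_interval_convex)
  fix u x y :: real
  assume u: "0 < u" "u < 1" and xy: "x \<in> G" "y \<in> G"
  let ?z = "(1 - u) * x + u * y" and ?m = "(1 - u) * \<Lambda> x + u * \<Lambda> y"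
  have z: "?z \<in> G" using \<open>convex G\<close> u xy by (auto simp: convex_alt)
  define A where "A s = {v. ?z * v - ?m \<le> s * v - \<Lambda> s}" for s
  have A: "closed (A s)" for s
    unfolding A_def by (intro closed_Collect_le continuous_intros)
  have "v \<in> A x \<union> A y" for v
  proof (rule ccontr)
    assume "\<not> ?thesis"
    then have "(1 - u) * (x * v - \<Lambda> x) + u * (y * v - \<Lambda> y) < (1 - u) * (?z * v - ?m) + u * (?z * v - ?m)"
      using u by (intro add_strict_mono mult_strict_left_mono) (auto simp: A_def)
    then show False by (simp add: algebra_simps)
  qed
  then have "UNIV = A x \<union> A y" by auto
  moreover have "Limsup F (tilt \<mu> t ?z ?m (A s)) \<le> 1" if "s \<in> G" for s
    using Limsup_tilt_le[of s "A s" ?z ?m "\<Lambda> s"] that by (auto simp: A_def)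
  then have "max (Limsup F (tilt \<mu> t ?z ?m (A x))) (Limsup F (tilt \<mu> t ?z ?m (A y))) \<le> 1"
    using xy by simp
  ultimately have "Limsup F (tilt \<mu> t ?z ?m UNIV) \<le> 1"
    using Limsup_tilt_Un[of "A x" "A y" ?z ?m] A order_trans by fastforce
  moreover have "Limsup F (tilt \<mu> t ?z ?m UNIV) = ennreal (exp (\<Lambda> ?z - ?m))"
    by (intro lim_imp_Limsup F_nontriv tilt_UNIV_tendsto z)
  ultimately have "\<Lambda> ?z - ?m \<le> 0" by simp
  then show "\<Lambda> ((1 - u) *\<^sub>R x + u *\<^sub>R y) \<le> (1 - u) * \<Lambda> x + u * \<Lambda> y" by simp
qed

text \<open>A supporting line of \<open>\<Lambda>\<close> at \<open>s\<close> with slope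
  \<open>d\<close> makes \<open>s\<close> a maximiser in the supremum defining
  \<open>rate d\<close>, which is therefore finite. This supplies points of the domain even if its
  interior is empty.\<close>

lemma subgradient_exists:
  assumes "s \<in> G"
  obtains d where "d \<in> edom rate" "\<And>q. q \<in> G \<Longrightarrow> \<Lambda> s + d * (q - s) \<le> \<Lambda> q"
proof -
  obtain d where d: "\<Lambda> s + d * (q - s) \<le> \<Lambda> q" if "q \<in> G" for q
    using convex_le_Inf_differential[OF convex_on_\<Lambda>, of s] assms open_G by (auto simp: interior_open)
  have "rate d \<le> ereal (s * d - \<Lambda> s)"
    unfolding rate_le_iff using d by (auto simp: algebra_simps)
  then have "d \<in> edom rate" unfolding edom_def by (auto intro: le_less_trans)
  then show ?thesis using that d by blast
qed

section \<open>Lower bounds at single points\<close>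

definition lower_bound_at :: "real \<Rightarrow> bool" where
  "lower_bound_at x \<longleftrightarrow>
    (\<forall>V. open V \<longrightarrow> x \<in> V \<longrightarrow> exp_neg (rate x) \<le> Liminf F (\<lambda>\<alpha>. mu_pow \<mu> t \<alpha> V))"

lemma mu_pow_mono:
  assumes "B \<subseteq> C" "C \<in> sets borel"
  shows "eventually (\<lambda>\<alpha>. mu_pow \<mu> t \<alpha> B \<le> mu_pow \<mu> t \<alpha> C) F"
  using t_pos sets_mu
  by eventually_elim (use assms in \<open>auto simp: mu_pow_def intro!: epow_mono emeasure_mono\<close>)

text \<open>The tilting parameter \<open>s\<close> is moved towards \<open>\<theta>\<close> from one side: then the slopes at \<open>s\<close> on
  either side are close to \<open>D\<close> even if \<open>\<Lambda>\<close> has a kink at \<open>\<theta>\<close>.\<close>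

lemma lower_bound_at_slopes:
  assumes "\<theta> \<in> G" and E: "E \<noteq> bot" "((\<lambda>s. s) \<longlongrightarrow> \<theta>) E" "(\<Lambda> \<longlongrightarrow> \<Lambda> \<theta>) E"
    and slopes: "\<And>a b. a < D \<Longrightarrow> D < b \<Longrightarrow> eventually (\<lambda>s. s \<in> G \<and> (\<exists>r\<in>G. \<exists>q\<in>G. r < s \<and> s < q \<and>
      a * (s - r) < \<Lambda> s - \<Lambda> r \<and> \<Lambda> q - \<Lambda> s < b * (q - s))) E"
  shows "lower_bound_at D"
  unfolding lower_bound_at_def
proof safe
  fix V :: "real set" assume V: "open V" "D \<in> V"
  let ?c = "Liminf F (\<lambda>\<alpha>. mu_pow \<mu> t \<alpha> V)"
  obtain e where e: "e > 0" "ball D e \<subseteq> V" using V openE by blast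
  \<comment> \<open>Two limits are taken in turn: with the radius \<open>d\<close> fixed,
    \<open>s\<close> tends to \<open>\<theta>\<close>; then \<open>d\<close> tends to 0. On the
    interval of radius \<open>d\<close> around \<open>D\<close>, \<open>s * y\<close> is at most
    \<open>s * D + \<bar>s\<bar> * d\<close>.\<close>
  have *: "ennreal (exp (\<Lambda> \<theta> - (\<theta> * D + \<bar>\<theta>\<bar> * d))) \<le> ?c" if d: "0 < d" "d < e" for d
  proof (rule tendsto_upperbound[OF _ _ E(1)])
    show "((\<lambda>s. ennreal (exp (\<Lambda> s - (s * D + \<bar>s\<bar> * d)))) \<longlongrightarrow> ennreal (exp (\<Lambda> \<theta> - (\<theta> * D + \<bar>\<theta>\<bar> * d)))) E"
      by (intro tendsto_intros E)
    have V': "{D - d<..<D + d} \<subseteq> V" using d by (intro order_trans[OF _ e(2)]) (auto simp: dist_real_def)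
    have "eventually (\<lambda>s. s \<in> G \<and> (\<exists>r\<in>G. \<exists>q\<in>G. r < s \<and> s < q \<and>
      (D - d) * (s - r) < \<Lambda> s - \<Lambda> r \<and> \<Lambda> q - \<Lambda> s < (D + d) * (q - s))) E"
      using d by (intro slopes) auto
    then show "eventually (\<lambda>s. ennreal (exp (\<Lambda> s - (s * D + \<bar>s\<bar> * d))) \<le> ?c) E"
    proof eventually_elim
      case (elim s)
      then obtain r q where rq: "s \<in> G" "r \<in> G" "q \<in> G" "r < s" "s < q"
        "(D - d) * (s - r) < \<Lambda> s - \<Lambda> r" "\<Lambda> q - \<Lambda> s < (D + d) * (q - s)" by blast
      have "s * y \<le> s * D + \<bar>s\<bar> * d" if "D - d < y" "y < D + d" for y
      proof -
        have "\<bar>y - D\<bar> \<le> d" using that by auto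
        then have "\<bar>s * (y - D)\<bar> \<le> \<bar>s\<bar> * d" by (simp add: abs_mult mult_left_mono)
        then show ?thesis by (simp add: algebra_simps)
      qed
      then have "ennreal (exp (\<Lambda> s - (s * D + \<bar>s\<bar> * d)))
          \<le> Liminf F (\<lambda>\<alpha>. mu_pow \<mu> t \<alpha> {D - d<..<D + d})"
        using rq by (intro Liminf_mu_pow_interval[of r s q]) auto
      also have "\<dots> \<le> ?c" using V V' by (intro Liminf_mono mu_pow_mono) auto
      finally show ?case .
    qed
  qed
  \<comment> \<open>One term of the supremum is enough, because a larger rate only weakens the
    claim.\<close>
  have "exp_neg (rate D) \<le> ennreal (exp (- (\<theta> * D - \<Lambda> \<theta>)))"
    by (intro exp_neg_le rate_ge assms)
  also have "ennreal (exp (- (\<theta> * D - \<Lambda> \<theta>))) \<le> ?c"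
  proof (rule tendsto_upperbound[OF _ _ trivial_limit_at_right_real])
    have "((\<lambda>d. ennreal (exp (\<Lambda> \<theta> - (\<theta> * D + \<bar>\<theta>\<bar> * d)))) \<longlongrightarrow> ennreal (exp (\<Lambda> \<theta> - (\<theta> * D + \<bar>\<theta>\<bar> * 0)))) (at_right 0)"
      by (intro tendsto_intros)
    then show "((\<lambda>d. ennreal (exp (\<Lambda> \<theta> - (\<theta> * D + \<bar>\<theta>\<bar> * d)))) \<longlongrightarrow> ennreal (exp (- (\<theta> * D - \<Lambda> \<theta>)))) (at_right 0)"
      by simp
    show "eventually (\<lambda>d. ennreal (exp (\<Lambda> \<theta> - (\<theta> * D + \<bar>\<theta>\<bar> * d))) \<le> ?c) (at_right 0)"
      using * e by (auto simp: eventually_at_right_field)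
  qed
  finally show "exp_neg (rate D) \<le> ?c" .
qed

text \<open>Some chord from a fixed \<open>r\<close> up to \<open>\<theta>\<close> has slope above
  \<open>a\<close>; by left continuity so has the chord from \<open>r\<close> to \<open>s\<close>,
  for \<open>s\<close> close to \<open>\<theta>\<close>. On the other side
  \<open>q = \<theta>\<close> serves, as the left difference quotients tend to
  \<open>D < b\<close>.\<close>

lemma lower_bound_at_left_derivative:
  assumes "\<theta> \<in> G" and D: "(\<Lambda> has_real_derivative D) (at_left \<theta>)"
  shows "lower_bound_at D"
proof (rule lower_bound_at_slopes[OF \<open>\<theta> \<in> G\<close>, of "at_left \<theta>"])
  show cont: "(\<Lambda> \<longlongrightarrow> \<Lambda> \<theta>) (at_left \<theta>)"
    using DERIV_continuous[OF D] by (simp add: continuous_within)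
  have quot: "((\<lambda>s. (\<Lambda> s - \<Lambda> \<theta>) / (s - \<theta>)) \<longlongrightarrow> D) (at_left \<theta>)"
    using D by (simp add: has_field_derivative_iff)
  have G: "eventually (\<lambda>s. s \<in> G) (at_left \<theta>)"
    using eventually_at_in_open'[OF open_G \<open>\<theta> \<in> G\<close>] by (rule filter_leD[OF at_le, rotated]) simp
  have less: "eventually (\<lambda>s. s < \<theta>) (at_left \<theta>)"
    by (simp add: eventually_at_filter)
  fix a b assume ab: "a < D" "D < b"
  have "eventually (\<lambda>r. r \<in> G \<and> r < \<theta> \<and> a < (\<Lambda> r - \<Lambda> \<theta>) / (r - \<theta>)) (at_left \<theta>)"
    using G less order_tendstoD(1)[OF quot ab(1)] by eventually_elim auto
  then obtain r where r: "r \<in> G" "r < \<theta>" "a < (\<Lambda> r - \<Lambda> \<theta>) / (r - \<theta>)"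
    using eventually_happens' trivial_limit_at_left_real by blast
  then have "0 < (\<Lambda> \<theta> - \<Lambda> r) - a * (\<theta> - r)" by (simp add: field_simps)
  moreover have "((\<lambda>s. (\<Lambda> s - \<Lambda> r) - a * (s - r)) \<longlongrightarrow> (\<Lambda> \<theta> - \<Lambda> r) - a * (\<theta> - r)) (at_left \<theta>)"
    by (intro tendsto_intros cont)
  ultimately have "eventually (\<lambda>s. 0 < (\<Lambda> s - \<Lambda> r) - a * (s - r)) (at_left \<theta>)"
    by (intro order_tendstoD(1))
  moreover have "eventually (\<lambda>s. r < s) (at_left \<theta>)"
    using r(2) eventually_at_left_real by (force elim: eventually_mono)
  ultimately show "eventually (\<lambda>s. s \<in> G \<and> (\<exists>r\<in>G. \<exists>q\<in>G. r < s \<and> s < q \<and>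
      a * (s - r) < \<Lambda> s - \<Lambda> r \<and> \<Lambda> q - \<Lambda> s < b * (q - s))) (at_left \<theta>)"
    using order_tendstoD(2)[OF quot ab(2)] G less
  proof eventually_elim
    case (elim s)
    then have "\<Lambda> \<theta> - \<Lambda> s < b * (\<theta> - s)" by (simp add: field_simps)
    with elim assms r show ?case by (intro conjI bexI[of _ r] bexI[of _ \<theta>]) auto
  qed
qed auto

text \<open>Mirror image of the left case: now \<open>r = \<theta>\<close>, and \<open>q\<close> is
  a fixed point to the right of \<open>\<theta>\<close>.\<close>

lemma lower_bound_at_right_derivative:
  assumes "\<theta> \<in> G" and D: "(\<Lambda> has_real_derivative D) (at_right \<theta>)"
  shows "lower_bound_at D"
proof (rule lower_bound_at_slopes[OF \<open>\<theta> \<in> G\<close>, of "at_right \<theta>"])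
  show cont: "(\<Lambda> \<longlongrightarrow> \<Lambda> \<theta>) (at_right \<theta>)"
    using DERIV_continuous[OF D] by (simp add: continuous_within)
  have quot: "((\<lambda>s. (\<Lambda> s - \<Lambda> \<theta>) / (s - \<theta>)) \<longlongrightarrow> D) (at_right \<theta>)"
    using D by (simp add: has_field_derivative_iff)
  have G: "eventually (\<lambda>s. s \<in> G) (at_right \<theta>)"
    using eventually_at_in_open'[OF open_G \<open>\<theta> \<in> G\<close>] by (rule filter_leD[OF at_le, rotated]) simp
  have less: "eventually (\<lambda>s. \<theta> < s) (at_right \<theta>)"
    by (simp add: eventually_at_filter)
  fix a b assume ab: "a < D" "D < b"
  have "eventually (\<lambda>q. q \<in> G \<and> \<theta> < q \<and> (\<Lambda> q - \<Lambda> \<theta>) / (q - \<theta>) < b) (at_right \<theta>)"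
    using G less order_tendstoD(2)[OF quot ab(2)] by eventually_elim auto
  then obtain q where q: "q \<in> G" "\<theta> < q" "(\<Lambda> q - \<Lambda> \<theta>) / (q - \<theta>) < b"
    using eventually_happens' trivial_limit_at_right_real by blast
  then have "0 < b * (q - \<theta>) - (\<Lambda> q - \<Lambda> \<theta>)" by (simp add: field_simps)
  moreover have "((\<lambda>s. b * (q - s) - (\<Lambda> q - \<Lambda> s)) \<longlongrightarrow> b * (q - \<theta>) - (\<Lambda> q - \<Lambda> \<theta>)) (at_right \<theta>)"
    by (intro tendsto_intros cont)
  ultimately have "eventually (\<lambda>s. 0 < b * (q - s) - (\<Lambda> q - \<Lambda> s)) (at_right \<theta>)"
    by (intro order_tendstoD(1))
  moreover have "eventually (\<lambda>s. s < q) (at_right \<theta>)"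
    using q(2) eventually_at_right_real by (force elim: eventually_mono)
  ultimately show "eventually (\<lambda>s. s \<in> G \<and> (\<exists>r\<in>G. \<exists>q\<in>G. r < s \<and> s < q \<and>
      a * (s - r) < \<Lambda> s - \<Lambda> r \<and> \<Lambda> q - \<Lambda> s < b * (q - s))) (at_right \<theta>)"
    using order_tendstoD(1)[OF quot ab(1)] G less
  proof eventually_elim
    case (elim s)
    then have "a * (s - \<theta>) < \<Lambda> s - \<Lambda> \<theta>" by (simp add: field_simps)
    with elim assms q show ?case by (intro conjI bexI[of _ \<theta>] bexI[of _ q]) auto
  qed
qed auto

text \<open>The term of the conjugate with parameter 0 bounds \<open>rate x\<close> below by
  \<open>- \<Lambda> 0\<close>, while the assumption gives every open neighbourhood of
  \<open>x\<close> a lower limit of at least \<open>exp (\<Lambda> 0)\<close>.\<close>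

lemma lower_bound_at_if_le_l1:
  assumes "0 \<in> G" "l1 F \<mu> t x \<le> - ereal (\<Lambda> 0)"
  shows "lower_bound_at x"
  unfolding lower_bound_at_def
proof safe
  fix V :: "real set" assume V: "open V" "x \<in> V"
  have "exp_neg (rate x) \<le> ennreal (exp (- (0 * x - \<Lambda> 0)))"
    by (intro exp_neg_le rate_ge assms)
  also have "\<dots> \<le> (INF V\<in>{V. open V \<and> x \<in> V}. Liminf F (\<lambda>\<alpha>. mu_pow \<mu> t \<alpha> V))"
    using assms(2) unfolding l1_def ereal_minus_le_minus
    by (intro exp_le_if_le_elog) simp
  also have "\<dots> \<le> Liminf F (\<lambda>\<alpha>. mu_pow \<mu> t \<alpha> V)" using V by (intro INF_lower) auto
  finally show "exp_neg (rate x) \<le> Liminf F (\<lambda>\<alpha>. mu_pow \<mu> t \<alpha> V)" .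
qed

text \<open>The points \<open>?w u\<close> with \<open>0 < u < 1\<close> are interior by convexity
  of the domain and enter \<open>V\<close> as \<open>u\<close> tends to 0. Convexity bounds their
  rates by the chord from \<open>rate x\<close> to \<open>rate z\<close>, whose value tends to
  \<open>rate x\<close>.\<close>

lemma lower_bound_at_segment:
  assumes int: "\<And>x. x \<in> interior (edom rate) \<Longrightarrow> lower_bound_at x"
    and z: "z \<in> interior (edom rate)" and x: "x \<in> edom rate"
  shows "lower_bound_at x"
  unfolding lower_bound_at_def
proof safe
  fix V :: "real set" assume V: "open V" "x \<in> V"
  obtain a where a: "rate x = ereal a" using x rate_edomE by blast
  obtain b where b: "rate z = ereal b" using z interior_subset rate_edomE by blast
  let ?w = "\<lambda>u. (1 - u) * x + u * z"
  have w: "(?w \<longlongrightarrow> (1 - 0) * x + 0 * z) (at_right 0)" by (intro tendsto_intros)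
  have "ennreal (exp (- a)) \<le> Liminf F (\<lambda>\<alpha>. mu_pow \<mu> t \<alpha> V)"
  proof (rule tendsto_upperbound[OF _ _ trivial_limit_at_right_real])
    have "((\<lambda>u. ennreal (exp (- ((1 - u) * a + u * b)))) \<longlongrightarrow> ennreal (exp (- ((1 - 0) * a + 0 * b)))) (at_right 0)"
      by (intro tendsto_intros)
    then show "((\<lambda>u. ennreal (exp (- ((1 - u) * a + u * b)))) \<longlongrightarrow> ennreal (exp (- a))) (at_right 0)"
      by simp
    have "eventually (\<lambda>u. ?w u \<in> V) (at_right 0)"
      using topological_tendstoD[OF w V(1)] V(2) by simp
    moreover have "eventually (\<lambda>u. u \<in> {0<..<1}) (at_right (0::real))"
      by (rule eventually_at_right_real) simp
    ultimately show "eventually (\<lambda>u. ennreal (exp (- ((1 - u) * a + u * b)))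
        \<le> Liminf F (\<lambda>\<alpha>. mu_pow \<mu> t \<alpha> V)) (at_right 0)"
    proof eventually_elim
      case (elim u)
      have "x - u *\<^sub>R (x - z) \<in> interior (edom rate)"
        using elim by (intro mem_interior_convex_shrink convex_edom_rate z x) auto
      then have "lower_bound_at (?w u)" by (intro int) (simp add: algebra_simps)
      then have "exp_neg (rate (?w u)) \<le> Liminf F (\<lambda>\<alpha>. mu_pow \<mu> t \<alpha> V)"
        using elim V by (simp add: lower_bound_at_def)
      moreover have "ennreal (exp (- ((1 - u) * a + u * b))) \<le> exp_neg (rate (?w u))"
        using elim a b by (intro exp_neg_ge rate_convex_comb rate_not_MInfty) auto
      ultimately show ?case by simp
    qed
  qed
  then show "exp_neg (rate x) \<le> Liminf F (\<lambda>\<alpha>. mu_pow \<mu> t \<alpha> V)" using a by (simp add: exp_neg_def)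
qed

text \<open>Outside the domain \<open>exp_neg\<close> vanishes. If the domain has nonempty interior,
  segments reach every point of it; otherwise, being convex, it is the single point
  \<open>x\<close>, and \<open>\<Lambda>\<close> turns out to be affine with derivative
  \<open>x\<close>.\<close>

lemma lower_bound_at_everywhere:
  assumes int: "\<And>x. x \<in> interior (edom rate) \<Longrightarrow> lower_bound_at x"
  shows "lower_bound_at x"
proof (cases "x \<in> edom rate")
  case False
  then show ?thesis by (auto simp: edom_def lower_bound_at_def exp_neg_def)
next
  case x: True
  show ?thesis
  proof (cases "interior (edom rate) = {}")
    case False
    then show ?thesis using lower_bound_at_segment[OF int] x by blast
  next
    case True
    have single: "d = x" if "d \<in> edom rate" for d
    proof (rule ccontr)
      assume "d \<noteq> x"
      then have "{min d x<..<max d x} \<noteq> {}" by (auto simp: min_def max_def)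
      moreover have "{min d x<..<max d x} \<subseteq> edom rate"
        using convex_edom_rate that x
        by (intro order_trans[OF _ closed_segment_subset[of d "edom rate" x]])
           (auto simp: closed_segment_eq_real_ivl min_def max_def)
      ultimately show False using True interior_maximal[of "{min d x<..<max d x}" "edom rate"] by auto
    qed
    \<comment> \<open>All subgradients lie in the domain, hence equal \<open>x\<close>. Exchanging
      the two points turns this inequality into an equation.\<close>
    have le: "\<Lambda> s + x * (q - s) \<le> \<Lambda> q" if "s \<in> G" "q \<in> G" for s q
      using subgradient_exists[OF that(1)] single that(2) by metis
    obtain s where s: "s \<in> G" using G_nonempty by blast
    have "((\<lambda>q. \<Lambda> s + x * (q - s)) has_real_derivative x) (at s)"
      by (auto intro!: derivative_eq_intros)
    moreover have "\<Lambda> s + x * (q - s) = \<Lambda> q" if "q \<in> G" for q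
      using le[OF s that] le[OF that s] by (simp add: algebra_simps)
    ultimately have "(\<Lambda> has_real_derivative x) (at s)"
      using has_field_derivative_transform_within_open[OF _ open_G s] by blast
    then show ?thesis
      using s lower_bound_at_left_derivative has_field_derivative_at_within by blast
  qed
qed

subsection \<open>Upper bounds\<close>

lemma Limsup_tilt_finite_Union:
  assumes "finite T" "\<And>i. i \<in> T \<Longrightarrow> B i \<in> sets borel" "\<And>i. i \<in> T \<Longrightarrow> Limsup F (tilt \<mu> t s m (B i)) \<le> c"
  shows "Limsup F (tilt \<mu> t s m (\<Union>i\<in>T. B i)) \<le> c"
  using assms
proof (induction T rule: finite_induct)
  case empty
  have "eventually (\<lambda>\<alpha>. tilt \<mu> t s m {} \<alpha> \<le> c) F"
    using t_pos by eventually_elim (simp add: tilt_def epow_def)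
  then show ?case by (simp add: Limsup_bounded)
next
  case (insert i T)
  have "Limsup F (tilt \<mu> t s m (B i \<union> (\<Union>i\<in>T. B i)))
      \<le> max (Limsup F (tilt \<mu> t s m (B i))) (Limsup F (tilt \<mu> t s m (\<Union>i\<in>T. B i)))"
    using insert by (intro Limsup_tilt_Un sets.finite_UN) auto
  also have "\<dots> \<le> c" using insert by auto
  finally show ?case by simp
qed

lemma Limsup_mu_pow_eq_tilt:
  "B \<in> sets borel \<Longrightarrow> Limsup F (\<lambda>\<alpha>. mu_pow \<mu> t \<alpha> B) = Limsup F (tilt \<mu> t 0 0 B)"
  by (intro Limsup_eq mu_pow_eq_tilt)

lemma Limsup_mu_pow_compact:
  assumes "compact K"
  shows "Limsup F (\<lambda>\<alpha>. mu_pow \<mu> t \<alpha> K) \<le> (SUP x\<in>K. exp_neg (rate x))"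
proof (rule dense_ge)
  fix c' assume c': "(SUP x\<in>K. exp_neg (rate x)) < c'"
  show "Limsup F (\<lambda>\<alpha>. mu_pow \<mu> t \<alpha> K) \<le> c'"
  proof (cases c')
    case (real c)
    with c' have "c > 0" by (cases "c = 0") auto
    \<comment> \<open>For \<open>x\<close> in \<open>K\<close>, \<open>rate x\<close> exceeds
      \<open>- ln c\<close>, so some term of the supremum does, which says that \<open>x\<close>
      lies in some \<open>U s\<close>. On \<open>U s\<close>, Chernoff's inequality with parameter
      \<open>s\<close> gives the bound \<open>c\<close>.\<close>
    define U where "U s = {y. \<Lambda> s - s * y < ln c}" for s
    have U: "open (U s)" for s
      unfolding U_def by (intro open_Collect_less continuous_intros)
    have "\<exists>s\<in>G. x \<in> U s" if "x \<in> K" for x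
    proof (rule ccontr)
      assume "\<not> ?thesis"
      then have "rate x \<le> ereal (- ln c)" by (auto simp: rate_le_iff U_def)
      then have "ennreal (exp (- (- ln c))) \<le> exp_neg (rate x)"
        by (intro exp_neg_ge rate_not_MInfty)
      also have "\<dots> \<le> (SUP x\<in>K. exp_neg (rate x))" using that by (rule SUP_upper)
      finally show False using c' real \<open>c > 0\<close> by simp
    qed
    then have "K \<subseteq> (\<Union>s\<in>G. U s)" by auto
    then obtain T where T: "T \<subseteq> G" "finite T" "K \<subseteq> (\<Union>s\<in>T. U s)"
      using compactE_image[OF \<open>compact K\<close>, of G U] U by auto
    have "Limsup F (\<lambda>\<alpha>. mu_pow \<mu> t \<alpha> K) = Limsup F (tilt \<mu> t 0 0 K)"
      using assms by (intro Limsup_mu_pow_eq_tilt borel_compact)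
    also have "\<dots> \<le> Limsup F (tilt \<mu> t 0 0 (\<Union>s\<in>T. U s))"
      by (rule Limsup_mono, use t_pos in eventually_elim) (use T in \<open>auto intro!: tilt_mono\<close>)
    also have "\<dots> \<le> c'"
    proof (rule Limsup_tilt_finite_Union)
      fix s assume "s \<in> T"
      then have "Limsup F (tilt \<mu> t 0 0 (U s)) \<le> ennreal (exp (\<Lambda> s - (\<Lambda> s - ln c)))"
        using T by (intro Limsup_tilt_le) (auto simp: U_def)
      then show "Limsup F (tilt \<mu> t 0 0 (U s)) \<le> c'" using real \<open>c > 0\<close> by simp
    qed (use T U in auto)
    finally show ?thesis .
  qed simp
qed

text \<open>Since \<open>G\<close> is a neighbourhood of 0, it contains \<open>h\<close> and
  \<open>- h\<close> for some \<open>h > 0\<close>. Chernoff's inequality with these parameters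
  pushes both tails beyond \<open>M\<close> below the level \<open>c\<close>, and what remains of
  \<open>C\<close> is compact.\<close>

lemma Limsup_mu_pow_closed:
  assumes "0 \<in> G" "closed C"
  shows "Limsup F (\<lambda>\<alpha>. mu_pow \<mu> t \<alpha> C) \<le> (SUP x\<in>C. exp_neg (rate x))"
proof (rule dense_ge)
  fix c' assume c': "(SUP x\<in>C. exp_neg (rate x)) < c'"
  show "Limsup F (\<lambda>\<alpha>. mu_pow \<mu> t \<alpha> C) \<le> c'"
  proof (cases c')
    case (real c)
    with c' have "c > 0" by (cases "c = 0") auto
    obtain e where e: "e > 0" "ball 0 e \<subseteq> G" using open_G \<open>0 \<in> G\<close> openE by blast
    define h where "h = e / 2"
    have h: "h > 0" "h \<in> G" "- h \<in> G" using e by (auto simp: h_def subset_iff)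
    \<comment> \<open>\<open>M\<close> is the least number for which
      \<open>\<Lambda> h - h * M\<close> and \<open>\<Lambda> (-h) - h * M\<close> are both at most
      \<open>ln c\<close>. It may be negative; then \<open>{-M..M}\<close> is empty and the two rays
      cover the line.\<close>
    define M where "M = max ((\<Lambda> h - ln c) / h) ((\<Lambda> (-h) - ln c) / h)"
    have M: "\<Lambda> h - h * M \<le> ln c" "\<Lambda> (-h) - h * M \<le> ln c"
    proof -
      have "(\<Lambda> h - ln c) / h \<le> M" "(\<Lambda> (-h) - ln c) / h \<le> M" by (auto simp: M_def)
      then show "\<Lambda> h - h * M \<le> ln c" "\<Lambda> (-h) - h * M \<le> ln c"
        using h by (auto simp: field_simps)
    qed
    have K: "compact (C \<inter> {-M..M})" using \<open>closed C\<close> by (intro closed_Int_compact) auto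
    have "Limsup F (tilt \<mu> t 0 0 (C \<inter> {-M..M})) = Limsup F (\<lambda>\<alpha>. mu_pow \<mu> t \<alpha> (C \<inter> {-M..M}))"
      using K by (intro Limsup_mu_pow_eq_tilt[symmetric] borel_compact)
    also have "\<dots> \<le> (SUP x\<in>C \<inter> {-M..M}. exp_neg (rate x))"
      by (rule Limsup_mu_pow_compact[OF K])
    also have "\<dots> \<le> (SUP x\<in>C. exp_neg (rate x))" by (rule SUP_subset_mono) auto
    also have "\<dots> \<le> c'" using c' by simp
    finally have 1: "Limsup F (tilt \<mu> t 0 0 (C \<inter> {-M..M})) \<le> c'" .
    have "Limsup F (tilt \<mu> t 0 0 {M..}) \<le> ennreal (exp (\<Lambda> h - h * M))"
      using h by (intro Limsup_tilt_le) auto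
    also have "\<dots> \<le> ennreal (exp (ln c))" using M by (intro ennreal_leI) simp
    finally have 2: "Limsup F (tilt \<mu> t 0 0 {M..}) \<le> c'" using real \<open>c > 0\<close> by simp
    have "Limsup F (tilt \<mu> t 0 0 {..-M}) \<le> ennreal (exp (\<Lambda> (-h) - h * M))"
    proof (rule Limsup_tilt_le[OF h(3)])
      fix y assume "y \<in> {..-M}"
      then have "h * M \<le> h * (- y)" using h by (intro mult_left_mono) auto
      then show "0 * y - 0 \<le> - h * y - h * M" by simp
    qed
    also have "\<dots> \<le> ennreal (exp (ln c))" using M by (intro ennreal_leI) simp
    finally have 3: "Limsup F (tilt \<mu> t 0 0 {..-M}) \<le> c'" using real \<open>c > 0\<close> by simp
    have "Limsup F (\<lambda>\<alpha>. mu_pow \<mu> t \<alpha> C) = Limsup F (tilt \<mu> t 0 0 C)"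
      using assms by (intro Limsup_mu_pow_eq_tilt borel_closed)
    also have "\<dots> \<le> Limsup F (tilt \<mu> t 0 0 (\<Union>B\<in>{C \<inter> {-M..M}, {M..}, {..-M}}. B))"
      by (rule Limsup_mono, use t_pos in eventually_elim) (auto intro!: tilt_mono)
    also have "\<dots> \<le> c'"
      by (rule Limsup_tilt_finite_Union) (use 1 2 3 K in \<open>auto intro: borel_compact\<close>)
    finally show ?thesis .
  qed simp
qed

text \<open>The class \<open>P\<close> is left open so that the compact and the closed case share
  this step.\<close>

lemma ldp_upper_on_rate:
  assumes upper: "\<And>C. P C \<Longrightarrow> Limsup F (\<lambda>\<alpha>. mu_pow \<mu> t \<alpha> C) \<le> (SUP x\<in>C. exp_neg (rate x))"
    and int: "\<And>x. x \<in> interior (edom rate) \<Longrightarrow> lower_bound_at x"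
  shows "ldp_upper_on P F \<mu> t rate"
proof -
  note lower = lower_bound_at_everywhere[OF int, unfolded lower_bound_at_def, rule_format]
  \<comment> \<open>A negative rate would make \<open>exp_neg (rate x)\<close> larger than 1,
    against the lower bound for \<open>UNIV\<close> and total masses of at most 1.\<close>
  have "0 \<le> rate x" for x
  proof (rule ccontr)
    assume "\<not> 0 \<le> rate x"
    then obtain c where c: "rate x = ereal c" "c < 0"
      using rate_not_MInfty[of x] by (cases "rate x") auto
    have "eventually (\<lambda>\<alpha>. mu_pow \<mu> t \<alpha> UNIV \<le> 1) F"
      using t_pos subprob_mu
    proof eventually_elim
      case (elim \<alpha>)
      then have "epow (emeasure (\<mu> \<alpha>) UNIV) (t \<alpha>) \<le> epow 1 (t \<alpha>)"
        by (intro epow_mono subprob_space.subprob_emeasure_le_1)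
      then show ?case by (simp add: mu_pow_def)
    qed
    then have "Limsup F (\<lambda>\<alpha>. mu_pow \<mu> t \<alpha> UNIV) \<le> 1" by (rule Limsup_bounded)
    moreover have "exp_neg (rate x) \<le> Liminf F (\<lambda>\<alpha>. mu_pow \<mu> t \<alpha> UNIV)" by (rule lower) auto
    ultimately have "exp_neg (rate x) \<le> 1"
      using Liminf_le_Limsup[OF F_nontriv, of "\<lambda>\<alpha>. mu_pow \<mu> t \<alpha> UNIV"] by simp
    with c show False by (simp add: exp_neg_def)
  qed
  then show ?thesis
    unfolding ldp_upper_on_def
    using upper lower_semicont_rate lower by (auto intro!: SUP_least)
qed

end

subsection \<open>Steep convex functions\<close>

text \<open>With slopes below \<open>D\<close>, \<open>g\<close> grows to the right of
  \<open>p\<close> at most linearly with slope \<open>D\<close>, while the conjugate bound at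
  \<open>D' > D\<close> demands growth with slope \<open>D'\<close>. Hence \<open>G\<close> ends at
  a finite \<open>b\<close>, and along a sequence tending to \<open>b\<close> the slopes stay
  between \<open>g' p\<close> and \<open>D\<close>, so steepness fails there.\<close>

lemma frontier_bounded_derivative:
  fixes g g' :: "real \<Rightarrow> real"
  assumes G: "open G" "is_interval G" "p \<in> G" and g: "convex_on G g"
    and deriv: "\<And>x. x \<in> G \<Longrightarrow> (g has_real_derivative g' x) (at x)"
    and less: "\<And>x. x \<in> G \<Longrightarrow> g' x < D"
    and D': "D < D'" "\<And>s. s \<in> G \<Longrightarrow> s * D' - g s \<le> M"
  shows "\<exists>b X. b \<in> frontier G \<and> (\<forall>n::nat. X n \<in> G) \<and> X \<longlonglongrightarrow> b \<and> (\<forall>n. \<bar>g' (X n)\<bar> \<le> \<bar>g' p\<bar> + \<bar>D\<bar>)"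
proof -
  have tangent: "g x + g' x * (y - x) \<le> g y" if "x \<in> G" "y \<in> G" for x y
    using convex_on_imp_above_tangent[OF g, of x y "g' x"] that G deriv
    by (auto simp: is_interval_connected interior_open has_field_derivative_at_within)
  have growth: "g s \<le> g p + D * (s - p)" if "s \<in> G" "p \<le> s" for s
  proof -
    have "g' s * (s - p) \<le> D * (s - p)" using less that by (intro mult_right_mono) (auto intro: less_imp_le)
    with tangent[OF that(1) G(3)] show ?thesis by (simp add: algebra_simps)
  qed
  \<comment> \<open>Combines \<open>s * D' - M \<le> g s\<close> with the growth bound.\<close>
  have "s \<le> (M + g p - D * p) / (D' - D)" if "s \<in> G" "p \<le> s" for s
    using D'(2)[OF that(1)] growth[OF that] D'(1) by (simp add: field_simps)
  then have above: "s \<le> max p ((M + g p - D * p) / (D' - D))" if "s \<in> G" for s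
    using that by (cases "p \<le> s") (auto simp: le_max_iff_disj)
  then have bdd: "bdd_above G" by (rule bdd_aboveI)
  define b where "b = Sup G"
  have b: "s \<le> b" if "s \<in> G" for s unfolding b_def using that bdd by (rule cSup_upper)
  have "b \<notin> G"
  proof
    assume "b \<in> G"
    then obtain e where e: "e > 0" "ball b e \<subseteq> G" using G openE by blast
    then have "b + e / 2 \<in> G" by (auto simp: subset_iff dist_real_def)
    with b[of "b + e / 2"] e show False by simp
  qed
  then have pb: "p < b" using b[OF G(3)] G(3) by (cases "p = b") auto
  have inG: "x \<in> G" if "p \<le> x" "x < b" for x
  proof -
    obtain y where "y \<in> G" "x < y" using \<open>x < b\<close> less_cSup_iff[OF _ bdd] G(3) b_def by blast
    then show ?thesis using mem_is_interval_1_I[OF G(2) G(3) _ that(1)] by simp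
  qed
  have "b \<in> frontier G"
    using closure_contains_Sup[OF _ bdd] G \<open>b \<notin> G\<close> by (auto simp: frontier_def b_def interior_open)
  moreover define X where "X n = b - (b - p) * inverse (real (Suc n))" for n
  moreover have X: "p \<le> X n" "X n < b" for n
  proof -
    have "(b - p) * inverse (real (Suc n)) \<le> (b - p) * 1"
      using pb by (intro mult_left_mono) (auto simp: field_simps)
    then show "p \<le> X n" by (simp add: X_def)
    show "X n < b" using pb by (simp add: X_def)
  qed
  moreover have "X \<longlonglongrightarrow> b - (b - p) * 0"
    unfolding X_def by (intro tendsto_intros LIMSEQ_inverse_real_of_nat)
  moreover have "\<bar>g' (X n)\<bar> \<le> \<bar>g' p\<bar> + \<bar>D\<bar>" for n
  proof -
    have G': "X n \<in> G" using inG X by blast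
    \<comment> \<open>Adding the two tangent inequalities gives monotonicity of the
      derivative.\<close>
    have "g' p * (X n - p) \<le> g' (X n) * (X n - p)"
      using tangent[OF G(3) G'] tangent[OF G' G(3)] by (simp add: algebra_simps)
    then have "g' p \<le> g' (X n)"
      using X(1)[of n] by (cases "X n = p") auto
    with less[OF G'] show ?thesis by auto
  qed
  ultimately show ?thesis using inG by (intro exI[of _ b] exI[of _ X]) auto
qed

text \<open>Finite conjugate values on both sides of \<open>D\<close>, together with steepness,
  prevent the slopes from all lying on one side of \<open>D\<close>. If slopes occur on both sides,
  Darboux's argument applies.\<close>

lemma convex_derivative_attained:
  fixes g g' :: "real \<Rightarrow> real"
  assumes G: "open G" "is_interval G" "G \<noteq> {}" and g: "convex_on G g"
    and deriv: "\<And>x. x \<in> G \<Longrightarrow> (g has_real_derivative g' x) (at x)"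
    and steep: "\<And>b X. b \<in> frontier G \<Longrightarrow> (\<And>n::nat. X n \<in> G) \<Longrightarrow> X \<longlonglongrightarrow> b \<Longrightarrow>
      filterlim (\<lambda>n. \<bar>g' (X n)\<bar>) at_top sequentially"
    and D: "D1 < D" "D < D2" "\<And>s. s \<in> G \<Longrightarrow> s * D1 - g s \<le> M1" "\<And>s. s \<in> G \<Longrightarrow> s * D2 - g s \<le> M2"
  shows "\<exists>x\<in>G. g' x = D"
proof (rule ccontr)
  assume ne: "\<not> ?thesis"
  obtain p where p: "p \<in> G" using G by blast
  have unbounded: False if "b \<in> frontier G" "\<And>n. X n \<in> G" "X \<longlonglongrightarrow> b" "\<And>n. \<bar>g' (X n)\<bar> \<le> M" for b X M
  proof -
    have "eventually (\<lambda>n. M < \<bar>g' (X n)\<bar>) sequentially"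
      using steep[OF that(1-3)] by (simp add: filterlim_at_top_dense)
    then obtain n where "M < \<bar>g' (X n)\<bar>" using eventually_happens' sequentially_bot by blast
    with that(4)[of n] show False by simp
  qed
  consider "\<forall>x\<in>G. g' x < D" | "\<forall>x\<in>G. D < g' x" | x y where "x \<in> G" "y \<in> G" "g' x < D" "D < g' y"
    using ne by (meson linorder_neqE_linordered_idom)
  then show False
  proof cases
    case 1
    have "\<exists>b X. b \<in> frontier G \<and> (\<forall>n::nat. X n \<in> G) \<and> X \<longlonglongrightarrow> b \<and> (\<forall>n. \<bar>g' (X n)\<bar> \<le> \<bar>g' p\<bar> + \<bar>D\<bar>)"
      by (rule frontier_bounded_derivative[where D' = D2 and M = M2])
         (rule G p g deriv D 1[rule_format] | assumption)+
    then show ?thesis using unbounded by blast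
  next
    case less: 2
    \<comment> \<open>Reflection at 0 reduces this case to
      \<open>frontier_bounded_derivative\<close>, with the conjugate bound at \<open>- D1\<close> in
      place of the one at \<open>D2\<close>.\<close>
    let ?G = "uminus ` G"
    have 1: "open ?G" "is_interval ?G" "- p \<in> ?G" using G p by (auto intro: open_negations)
    have convex: "convex_on ?G (\<lambda>x. g (- x))"
    proof (rule convex_onI)
      fix u x y :: real assume "0 < u" "u < 1" "x \<in> ?G" "y \<in> ?G"
      then show "g (- ((1 - u) *\<^sub>R x + u *\<^sub>R y)) \<le> (1 - u) * g (- x) + u * g (- y)"
        using convex_onD[OF g, of u "- x" "- y"] by auto
    qed (use 1 is_interval_convex in blast)
    have 3: "((\<lambda>x. g (- x)) has_real_derivative - g' (- x)) (at x)" if "x \<in> ?G" for x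
    proof -
      have "(g has_real_derivative g' (- x)) (at (- x))" using that by (intro deriv) auto
      then show ?thesis by (simp add: DERIV_mirror)
    qed
    have 4: "- g' (- x) < - D" if "x \<in> ?G" for x using that less by auto
    have 5: "s * (- D1) - g (- s) \<le> M1" if "s \<in> ?G" for s using that D(3) by auto
    have 6: "- D < - D1" using D(1) by simp
    have "\<exists>b X. b \<in> frontier ?G \<and> (\<forall>n::nat. X n \<in> ?G) \<and> X \<longlonglongrightarrow> b \<and>
        (\<forall>n. \<bar>- g' (- X n)\<bar> \<le> \<bar>- g' (- (- p))\<bar> + \<bar>- D\<bar>)"
      by (rule frontier_bounded_derivative[where g = "\<lambda>x. g (- x)" and D' = "- D1" and M = M1])
         (rule 1 convex 3 4 5 6 | assumption)+
    then obtain b X where bX: "b \<in> frontier ?G" "\<And>n::nat. X n \<in> ?G" "X \<longlonglongrightarrow> b"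
        "\<And>n. \<bar>- g' (- X n)\<bar> \<le> \<bar>- g' (- (- p))\<bar> + \<bar>- D\<bar>" by blast
    have "- b \<in> frontier G"
      unfolding frontier_def
    proof
      have "(\<lambda>n. - X n) \<longlonglongrightarrow> - b" by (intro tendsto_minus bX)
      moreover have "- X n \<in> G" for n using bX(2)[of n] by auto
      ultimately show "- b \<in> closure G" unfolding closure_sequential
        by (intro exI[of _ "\<lambda>n. - X n"]) simp
      have "b \<notin> ?G" using bX(1) 1(1) by (simp add: frontier_def interior_open)
      moreover have "b \<in> ?G" if "- b \<in> G" using imageI[OF that, of uminus] by simp
      ultimately show "- b \<notin> interior G" using interior_subset by blast
    qed
    moreover have "- X n \<in> G" for n using bX(2)[of n] by auto
    moreover have "(\<lambda>n. - X n) \<longlonglongrightarrow> - b" by (intro tendsto_minus bX)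
    moreover have "\<bar>g' (- X n)\<bar> \<le> \<bar>g' p\<bar> + \<bar>D\<bar>" for n using bX(4)[of n] by simp
    ultimately show ?thesis by (rule unbounded)
  next
    case 3
    have tangent: "g x + g' x * (y - x) \<le> g y" if "x \<in> G" "y \<in> G" for x y
      using convex_on_imp_above_tangent[OF g, of x y "g' x"] that G deriv
      by (auto simp: is_interval_connected interior_open has_field_derivative_at_within)
    have "g' x * (y - x) \<le> g' y * (y - x)"
      using tangent[OF 3(1,2)] tangent[OF 3(2,1)] by (simp add: algebra_simps)
    then have xy: "x < y" using 3 by (cases "x < y"; cases "x = y") auto
    have sub: "{x..y} \<subseteq> G" using mem_is_interval_1_I[OF G(2) 3(1,2)] by auto
    \<comment> \<open>The derivative of \<open>?h\<close> is negative at \<open>x\<close> and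
      positive at \<open>y\<close>, so the minimum over \<open>{x..y}\<close> is attained at an
      inner point \<open>z\<close>, where \<open>g' z = D\<close>.\<close>
    let ?h = "\<lambda>v. g v - D * v"
    have h: "(?h has_real_derivative g' v - D) (at v)" if "v \<in> G" for v
      by (auto intro!: derivative_eq_intros deriv that)
    have "continuous_on {x..y} ?h"
      using h sub by (intro DERIV_continuous_on) (blast intro: has_field_derivative_at_within)
    then obtain z where z: "z \<in> {x..y}" "\<And>v. v \<in> {x..y} \<Longrightarrow> ?h z \<le> ?h v"
      using continuous_attains_inf[of "{x..y}" ?h] xy by auto
    have "z \<noteq> x"
    proof
      assume "z = x"
      obtain d where "d > 0" "\<And>e. 0 < e \<Longrightarrow> e < d \<Longrightarrow> ?h (x + e) < ?h x"
        using DERIV_neg_dec_right[OF h[OF 3(1)]] 3 by auto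
      \<comment> \<open>The increment \<open>min (d / 2) (y - x)\<close> is below \<open>d\<close>
        and keeps the point inside \<open>{x..y}\<close>.\<close>
      then have "?h (x + min (d / 2) (y - x)) < ?h x" using xy by (auto simp: min_def)
      moreover have "?h x \<le> ?h (x + min (d / 2) (y - x))"
        using z(2)[of "x + min (d / 2) (y - x)"] \<open>z = x\<close> xy \<open>d > 0\<close> by auto
      ultimately show False by simp
    qed
    moreover have "z \<noteq> y"
    proof
      assume "z = y"
      obtain d where "d > 0" "\<And>e. 0 < e \<Longrightarrow> e < d \<Longrightarrow> ?h (y - e) < ?h y"
        using DERIV_pos_inc_left[OF h[OF 3(2)]] 3 by auto
      then have "?h (y - min (d / 2) (y - x)) < ?h y" using xy by (auto simp: min_def)
      moreover have "?h y \<le> ?h (y - min (d / 2) (y - x))"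
        using z(2)[of "y - min (d / 2) (y - x)"] \<open>z = y\<close> xy \<open>d > 0\<close> by auto
      ultimately show False by simp
    qed
    ultimately have "x < z" "z < y" using z(1) by auto
    have "?h z \<le> ?h v" if "\<bar>z - v\<bar> < min (z - x) (y - z)" for v
      using that by (intro z(2)) auto
    then have "g' z - D = 0"
      using \<open>x < z\<close> \<open>z < y\<close> z(1) sub
      by (intro DERIV_local_min[OF h, of z "min (z - x) (y - z)"]) auto
    then show False using ne z(1) sub by auto
  qed
qed

subsection \<open>Nets\<close>

text \<open>By directedness the tails form a filter base, and reflexivity keeps each tail
  nonempty.\<close>

lemma net_filter_nontriv:
  assumes "directed_set A le"
  shows "net_filter A le \<noteq> bot"
proof -
  let ?P = "\<lambda>a. principal {b \<in> A. le a b}"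
  have "A \<noteq> {}" using assms by (simp add: directed_set_def)
  have base: "\<exists>c\<in>A. ?P c \<le> inf (?P a) (?P b)" if ab: "a \<in> A" "b \<in> A" for a b
  proof -
    obtain c where c: "c \<in> A" "le a c" "le b c"
      using assms ab unfolding directed_set_def by blast
    have trans: "le x d" if "x \<in> A" "le x c" "d \<in> A" "le c d" for x d
      using assms that c(1) unfolding directed_set_def by blast
    have "{d \<in> A. le c d} \<subseteq> {d \<in> A. le a d} \<inter> {d \<in> A. le b d}"
      using c ab trans by blast
    then show ?thesis using c(1) by (intro bexI[of _ c]) simp_all
  qed
  have refl: "le a a" if "a \<in> A" for a using assms that by (simp add: directed_set_def)
  have "eventually (\<lambda>_. False) (net_filter A le) \<longleftrightarrow> (\<exists>a\<in>A. eventually (\<lambda>_. False) (?P a))"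
    unfolding net_filter_def using \<open>A \<noteq> {}\<close> base by (rule eventually_INF_base)
  then show ?thesis using refl by (auto simp: trivial_limit_def eventually_principal)
qed

lemma eventually_net_filter:
  assumes "directed_set A le" "\<And>\<alpha>. \<alpha> \<in> A \<Longrightarrow> P \<alpha>"
  shows "eventually P (net_filter A le)"
proof -
  obtain a where "a \<in> A" using assms by (auto simp: directed_set_def)
  then show ?thesis
    unfolding net_filter_def using assms(2) by (intro eventually_INF1[of a]) (auto simp: eventually_principal)
qed

text \<open>Finiteness of L excludes the limits 0 and \<open>\<infinity>\<close>, the values at
  which \<open>elog\<close> is infinite; between them \<open>exp\<close> inverts
  \<open>elog\<close>.\<close>

lemma laplace_pow_tendsto:
  assumes "F \<noteq> bot" "L_exists F \<mu> t s" "\<bar>L_fun F \<mu> t s\<bar> \<noteq> \<infinity>"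
  shows "(laplace_pow \<mu> t s \<longlongrightarrow> ennreal (exp (real_of_ereal (L_fun F \<mu> t s)))) F"
proof -
  obtain l where l: "(laplace_pow \<mu> t s \<longlongrightarrow> l) F" using assms by (auto simp: L_exists_def)
  then have L: "L_fun F \<mu> t s = elog l" using assms(1) by (simp add: L_fun_def tendsto_Lim)
  with assms(3) have "l \<noteq> 0" "l \<noteq> \<infinity>" by (auto simp: elog_def)
  then have "ennreal (exp (real_of_ereal (elog l))) = l"
    by (cases l) (auto simp: elog_def)
  with l L show ?thesis by simp
qed

text \<open>The domain of \<open>ext_infty L G\<close> is \<open>G\<close>, so steepness holds at
  the frontier of \<open>G\<close>. An interior point \<open>D\<close> of the domain of
  \<open>rate\<close> has neighbours of finite rate on both sides, as
  \<open>convex_derivative_attained\<close> requires.\<close>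

lemma (in gaertner_ellis) derivative_attained_if_essentially_smooth:
  assumes L: "\<And>s. s \<in> G \<Longrightarrow> L s = ereal (\<Lambda> s)" and smooth: "essentially_smooth (ext_infty L G)"
    and D: "D \<in> interior (edom rate)"
  shows "\<exists>x\<in>G. (\<Lambda> has_real_derivative D) (at x)"
proof -
  let ?f = "\<lambda>y. real_of_ereal (ext_infty L G y)"
  have dom: "edom (ext_infty L G) = G" using L by (auto simp: edom_def ext_infty_def)
  have "interior G = G" using open_G by (rule interior_open)
  note smooth = smooth[unfolded essentially_smooth_def dom this]
  have deriv: "(\<Lambda> has_real_derivative deriv ?f x) (at x)" if "x \<in> G" for x
  proof -
    have "(?f has_real_derivative deriv ?f x) (at x)"
      using smooth that by (simp add: DERIV_deriv_iff_real_differentiable)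
    then show ?thesis
      by (rule has_field_derivative_transform_within_open[OF _ open_G that]) (simp add: ext_infty_def L)
  qed
  obtain e where e: "e > 0" "ball D e \<subseteq> edom rate"
    using D unfolding mem_interior by blast
  have near: "D - e / 2 \<in> edom rate" "D + e / 2 \<in> edom rate"
    using e by (auto simp: subset_iff dist_real_def)
  obtain M1 where M1: "rate (D - e / 2) = ereal M1" using near rate_edomE by blast
  obtain M2 where M2: "rate (D + e / 2) = ereal M2" using near rate_edomE by blast
  have "\<exists>x\<in>G. deriv ?f x = D"
  proof (rule convex_derivative_attained[OF open_G interval_G G_nonempty convex_on_\<Lambda> deriv])
    show "D - e / 2 < D" "D < D + e / 2" using e by auto
    show "s * (D - e / 2) - \<Lambda> s \<le> M1" "s * (D + e / 2) - \<Lambda> s \<le> M2" if "s \<in> G" for s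
      using M1 M2 that rate_le_iff[of "D - e / 2" M1] rate_le_iff[of "D + e / 2" M2] by auto
  qed (use smooth in auto)
  then show ?thesis using deriv by auto
qed

theorem corollary1:
  fixes A :: "'i set" and le :: "'i \<Rightarrow> 'i \<Rightarrow> bool"
    and \<mu> :: "'i \<Rightarrow> real measure" and t :: "'i \<Rightarrow> real" and G :: "real set"
  defines "F \<equiv> net_filter A le"
  defines "L \<equiv> L_fun F \<mu> t"
  assumes "directed_set A le"
    and "\<And>\<alpha>. \<alpha> \<in> A \<Longrightarrow> radon_subprob (\<mu> \<alpha>)"
    and "\<And>\<alpha>. \<alpha> \<in> A \<Longrightarrow> 0 < t \<alpha>"
    and "(t \<longlongrightarrow> 0) F"
    and "open G" and "is_interval G" and "G \<noteq> {}"
    and "\<And>s. s \<in> G \<Longrightarrow> L_exists F \<mu> t s \<and> \<bar>L s\<bar> \<noteq> \<infinity>"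
  shows
    "(interior (edom (conj_on L G)) \<subseteq> ran_left_deriv L G \<union> ran_right_deriv L G
        \<longrightarrow> vague_LDP F \<mu> t (conj_on L G)) \<and>
     (essentially_smooth (ext_infty L G)
        \<longrightarrow> interior (edom (conj_on L G)) \<subseteq> ran_left_deriv L G \<union> ran_right_deriv L G) \<and>
     (0 \<in> G \<and>
      interior (edom (conj_on L G)) \<inter> {x. l1 F \<mu> t x > - L 0}
        \<subseteq> ran_left_deriv L G \<union> ran_right_deriv L G
        \<longrightarrow> narrow_LDP F \<mu> t (conj_on L G))"
proof -
  define \<Lambda> where "\<Lambda> s = real_of_ereal (L s)" for s
  have L: "L s = ereal (\<Lambda> s)" if "s \<in> G" for s
    using assms(10)[OF that] by (auto simp: \<Lambda>_def ereal_real)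
  have F: "F \<noteq> bot" unfolding F_def by (rule net_filter_nontriv) fact
  have sets: "sets (\<mu> \<alpha>) = sets borel" and subprob: "subprob_space (\<mu> \<alpha>)" if "\<alpha> \<in> A" for \<alpha>
    using assms(4)[OF that] by (auto simp: radon_subprob_def)
  interpret gaertner_ellis F t \<mu> \<Lambda> G
  proof
    show "eventually (\<lambda>\<alpha>. 0 < t \<alpha>) F" "eventually (\<lambda>\<alpha>. sets (\<mu> \<alpha>) = sets borel) F"
      "eventually (\<lambda>\<alpha>. subprob_space (\<mu> \<alpha>)) F"
      unfolding F_def using assms(3,5) sets subprob by (auto intro: eventually_net_filter)
    show "(laplace_pow \<mu> t s \<longlongrightarrow> ennreal (exp (\<Lambda> s))) F" if "s \<in> G" for s
      unfolding \<Lambda>_def L_def using assms(10)[OF that] F by (intro laplace_pow_tendsto) (auto simp: L_def)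
  qed (use assms F in auto)
  \<comment> \<open>The conjugate evaluates \<open>L\<close> on \<open>G\<close> only, where it
    agrees with \<open>\<Lambda>\<close>.\<close>
  have rate: "conj_on L G = rate" by (auto simp: conj_on_def L fun_eq_iff intro!: SUP_cong)
  have lower: "lower_bound_at D" if "D \<in> ran_left_deriv L G \<union> ran_right_deriv L G" for D
    using that lower_bound_at_left_derivative lower_bound_at_right_derivative
    unfolding ran_left_deriv_def ran_right_deriv_def \<Lambda>_def[abs_def] by blast
  have "vague_LDP F \<mu> t rate"
    if "interior (edom rate) \<subseteq> ran_left_deriv L G \<union> ran_right_deriv L G"
    unfolding vague_LDP_def using that lower
    by (intro ldp_upper_on_rate Limsup_mu_pow_compact) auto
  \<comment> \<open>The derivative obtained here is two-sided, hence in particular a left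
    derivative.\<close>
  moreover have "D \<in> ran_left_deriv L G"
    if "essentially_smooth (ext_infty L G)" "D \<in> interior (edom rate)" for D
    using derivative_attained_if_essentially_smooth[OF L that]
    by (auto simp: ran_left_deriv_def \<Lambda>_def[abs_def] intro: has_field_derivative_at_within)
  moreover have "narrow_LDP F \<mu> t rate"
    if "0 \<in> G" and "interior (edom rate) \<inter> {x. l1 F \<mu> t x > - L 0} \<subseteq> ran_left_deriv L G \<union> ran_right_deriv L G"
    unfolding narrow_LDP_def
  proof (rule ldp_upper_on_rate)
    fix x assume x: "x \<in> interior (edom rate)"
    show "lower_bound_at x"
    \<comment> \<open>Points with \<open>l1\<close> above \<open>- L 0\<close> fall under the range
      condition, the others under \<open>lower_bound_at_if_le_l1\<close>.\<close>
    proof (cases "l1 F \<mu> t x > - L 0")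
      case True
      then show ?thesis using that x lower by blast
    next
      case False
      then show ?thesis
        using lower_bound_at_if_le_l1[OF that(1), of x] L[OF that(1)] by (simp add: not_less)
    qed
  qed (rule Limsup_mu_pow_closed[OF that(1)])
  ultimately show ?thesis unfolding rate by blast
qed

end
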